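(* Let $f:(\mathbb{C}^n,0)\to(\mathbb{C}^n,0)$ be a germ of biholomorphism whose components have the form $$f_i(x_1,\dots,x_n)=x_i\Big(1+\mathbf{x}^M\big(a_i+A_i(x_1,\dots,x_n)\big)\Big),\qquad i=1,\dots,n,$$ where $M=(M_1,\dots,M_n)\in\mathbb{N}^n$, $\mathbf{x}^M=x_1^{M_1}\cdots x_n^{M_n}$, $a_i\in\mathbb{C}^*$, and $A_i:(\mathbb{C}^n,0)\to(\mathbb{C},0)$ is a holomorphic germ for every $i$. Let $\langle a,M\rangle=\sum_{i=1}^n a_iM_i$, assumed nonzero, and suppose that there exists $i\in\{1,\dots,n\}$ such that $\operatorname{Re}\left(\frac{a_i}{\langle a,M\rangle}\right)<0$. Then there exists a neighbourhood $U$ of the origin such that for any $p\in U$ outside of the fixed point set $\{\mathbf{x}^M=0\}$, there exists $j\in\mathbb{N}$ such that $f^{\circ j}(p)\notin U$ and there exists $j'\in\mathbb{N}$ such that $f^{\circ -j'}(p)\notin U$.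
   Context: $\mathbb{N}=\{0,1,2,\dots\}$. $f^{\circ j}$ is the $j$-th iterate of $f$ and $f^{\circ -j}$ the $j$-th iterate of $f^{-1}$. The neighbourhood $U$ is understood to be small enough that representatives of $f$ and $f^{-1}$ are defined on it; "$f^{\circ j}(p)\notin U$ for some $j$" means that the forward orbit of $p$ leaves $U$ (the iterates being taken as long as the orbit stays in $U$), and similarly for the backward orbit.
   Formalization: Fix an i with Re(a_i/⟨a,M⟩)<0; if M_i=0, the conclusion is proved only for p with p_i≠0, since otherwise it fails: f(x,y)=(x(1+x),y(1−x)), M=(1,0), a=(1,−1), p=(−ε,0). If M_i≥1 nothing is changed. *)

theory Defs
  imports "HOL-Analysis.Analysis"
begin

(* Holomorphy in several variables, as real Frechet differentiability with a
   complex-linear differential at every point. Only used for open S. *)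
definition holomorphic_scalar_on :: "(complex ^ 'n \<Rightarrow> complex) \<Rightarrow> (complex ^ 'n) set \<Rightarrow> bool"
  where "holomorphic_scalar_on h S \<longleftrightarrow>
    (\<forall>x\<in>S. \<exists>D. (h has_derivative D) (at x) \<and> (\<forall>c v. D (c *s v) = c * D v))"

definition holomorphic_map_on :: "(complex ^ 'n \<Rightarrow> complex ^ 'm) \<Rightarrow> (complex ^ 'n) set \<Rightarrow> bool"
  where "holomorphic_map_on h S \<longleftrightarrow> (\<forall>i. holomorphic_scalar_on (\<lambda>x. h x $ i) S)"

(* h represents a holomorphic germ (C^n,0) \<rightarrow> (C,0). Here and below functions are total;
   values far from the origin carry no information. *)
definition holomorphic_germ :: "(complex ^ 'n \<Rightarrow> complex) \<Rightarrow> bool"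
  where "holomorphic_germ h \<longleftrightarrow> h 0 = 0 \<and> (\<exists>S. open S \<and> 0 \<in> S \<and> holomorphic_scalar_on h S)"

(* f on W, with inverse g on V, represents a germ of biholomorphism (C^n,0) \<rightarrow> (C^n,0). *)
definition biholomorphic_germ ::
  "(complex ^ 'n \<Rightarrow> complex ^ 'n) \<Rightarrow> (complex ^ 'n) set \<Rightarrow>
   (complex ^ 'n \<Rightarrow> complex ^ 'n) \<Rightarrow> (complex ^ 'n) set \<Rightarrow> bool"
  where "biholomorphic_germ f W g V \<longleftrightarrow>
    open W \<and> 0 \<in> W \<and> open V \<and> 0 \<in> V \<and> f 0 = 0 \<and>
    f ` W = V \<and> g ` V = W \<and> (\<forall>x\<in>W. g (f x) = x) \<and> (\<forall>y\<in>V. f (g y) = y) \<and>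
    holomorphic_map_on f W \<and> holomorphic_map_on g V"

definition monomial :: "nat ^ 'n \<Rightarrow> complex ^ 'n \<Rightarrow> complex"
  where "monomial M x = (\<Prod>k\<in>UNIV. (x $ k) ^ (M $ k))"

definition weight :: "complex ^ 'n \<Rightarrow> nat ^ 'n \<Rightarrow> complex"
  where "weight a M = (\<Sum>k\<in>UNIV. a $ k * of_nat (M $ k))"

(* The iterates before the exit time stay in U, so for U inside the domain of a
   representative h only meaningful values of h are used. *)
definition orbit_leaves :: "('a \<Rightarrow> 'a) \<Rightarrow> 'a set \<Rightarrow> 'a \<Rightarrow> bool"
  where "orbit_leaves h U p \<longleftrightarrow> (\<exists>j. (\<forall>k<j. (h ^^ k) p \<in> U) \<and> (h ^^ j) p \<notin> U)"

(* A caveat on the theorem stated with these notions. Let i be an index with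
   Re (a_i / <a,M>) < 0. If M_i = 0, the hyperplane x_i = 0 is invariant and not contained
   in {x^M = 0}, and orbits inside it may converge to the origin: take
   f (x, y) = (x (1 + x), y (1 - x)), M = (1, 0), a = (1, -1), i = 2, p = (-\<epsilon>, 0).
   Points of that hyperplane therefore have to be excluded when M_i = 0.
   When M_i \<ge> 1 the complement of {x^M = 0} already avoids it, and nothing is excluded. *)

end

(* In the coordinate u = 1 / (<a,M> x^M) the map f is close to the translation u |-> u - 1, and it
   multiplies x_i by about 1 + (a_i/<a,M>) / u. Along an orbit of f that stays near the origin
   u_j is close to -j, and along one of the inverse it is close to j. In both cases
   Re (a_i/<a,M>) < 0 makes |x_i| grow at every step by a factor of at least 1 + c/j, so
   the divergence of the harmonic series contradicts boundedness. *)

theory Submission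
  imports Defs
begin

section \<open>Sequences whose growth is driven by the harmonic series\<close>

text \<open>The product of the growth factors dominates one plus the partial sums of
  \<open>c / j\<close>, so a bound on \<open>r\<close> would make the harmonic series summable. For
  \<open>N = 0\<close> the factor at \<open>j = 0\<close> is 1, as \<open>c / 0 = 0\<close>.\<close>

lemma unbounded_of_harmonic_growth:
  fixes r :: "nat \<Rightarrow> real"
  assumes c: "c > 0" and pos: "\<And>j. r j > 0"
    and growth: "\<And>j. j \<ge> N \<Longrightarrow> r (Suc j) \<ge> r j * (1 + c / real j)"
  shows "\<exists>j. r j > B"
proof (rule ccontr)
  assume "\<not> ?thesis"
  then have bounded: "r j \<le> B" for j
    by (meson not_le)
  have lower: "r (k + N) \<ge> r N * (1 + (\<Sum>j<k. c / real (j + N)))" for k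
  proof (induction k)
    case (Suc k)
    let ?S = "\<Sum>j<k. c / real (j + N)" and ?t = "c / real (k + N)"
    have "?S \<ge> 0" "?t \<ge> 0"
      using c by (auto intro!: sum_nonneg)
    then have "1 + (?S + ?t) \<le> (1 + ?S) * (1 + ?t)"
      using mult_nonneg_nonneg[of ?S ?t] unfolding distrib_left distrib_right by linarith
    then have "r N * (1 + (?S + ?t)) \<le> r N * (1 + ?S) * (1 + ?t)"
      using pos[of N] by (simp add: mult.assoc)
    also have "\<dots> \<le> r (k + N) * (1 + ?t)"
      using Suc.IH \<open>?t \<ge> 0\<close> by (intro mult_right_mono) auto
    also have "\<dots> \<le> r (Suc k + N)"
      using growth[of "k + N"] by simp
    finally show ?case by simp
  qed simp
  have "summable (\<lambda>j. c / real (j + N))"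
  proof (rule summableI_nonneg_bounded)
    show "(\<Sum>j<k. c / real (j + N)) \<le> B / r N" for k
    proof -
      have "r N * (\<Sum>j<k. c / real (j + N)) \<le> r N * (1 + (\<Sum>j<k. c / real (j + N)))"
        using pos[of N] by simp
      also have "\<dots> \<le> B"
        using lower[of k] bounded[of "k + N"] by linarith
      finally show ?thesis
        using pos[of N] by (simp add: field_simps)
    qed
  qed (use c in simp)
  then have "summable (\<lambda>j. inverse c * (c / real j))"
    using summable_iff_shift[of "\<lambda>j. c / real j" N] by (intro summable_mult) auto
  then have "summable (\<lambda>j. inverse (real j))"
    using c by (simp add: field_simps)
  then show False
    using not_summable_harmonic[where 'a = real] by simp
qed

text \<open>The hypotheses force \<open>v j = j (1 + O(\<delta>))\<close>, hence \<open>Re (z j) \<ge> Re b / (2 j)\<close>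
  for large \<open>j\<close>.\<close>

lemma unbounded_of_near_translation:
  fixes v y z :: "nat \<Rightarrow> complex"
  assumes b: "Re b > 0" and \<delta>: "\<delta> > 0" "4 * \<delta> \<le> 1" "4 * \<delta> * (1 + 2 * norm b) \<le> Re b"
    and v: "\<And>j. norm (v (Suc j) - v j - 1) \<le> \<delta>"
    and z: "\<And>j. norm (z j * v j - b) \<le> \<delta>"
    and y: "\<And>j. y (Suc j) = y j * (1 + z j)" "\<And>j. y j \<noteq> 0"
  shows "\<exists>j. norm (y j) > B"
proof -
  \<comment> \<open>The errors of the single steps add up, so the deviation from a translation is
    linear in \<open>j\<close> with small slope \<delta>.\<close>
  have drift: "norm (v j - v 0 - of_nat j) \<le> \<delta> * real j" for j
  proof (induction j)
    case (Suc j)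
    have "v (Suc j) - v 0 - of_nat (Suc j) = (v j - v 0 - of_nat j) + (v (Suc j) - v j - 1)"
      by simp
    then have "norm (v (Suc j) - v 0 - of_nat (Suc j)) \<le> \<delta> * real j + \<delta>"
      using Suc.IH v[of j] by (metis add_mono norm_triangle_le)
    then show ?case by (simp add: algebra_simps)
  qed simp
  \<comment> \<open>From \<open>N\<close> on, the initial offset \<open>v 0\<close> costs at most
    another \<open>\<delta> * real j\<close>. The bound \<open>N \<ge> 1\<close> makes later
    divisions by \<open>real j\<close> genuine.\<close>
  obtain N :: nat where N: "N \<ge> 1" "norm (v 0) \<le> \<delta> * real N"
  proof -
    obtain n :: nat where "norm (v 0) / \<delta> \<le> real n"
      using real_arch_simple by blast
    then have "norm (v 0) \<le> \<delta> * real (Suc n)"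
      using \<delta>(1) by (simp add: field_simps)
    then show thesis by (intro that[of "Suc n"]) auto
  qed
  have "norm (y (Suc j)) \<ge> norm (y j) * (1 + Re b / 2 / real j)" if "j \<ge> N" for j
  proof -
    have j: "real j > 0" using that N(1) by simp
    have "\<delta> * real N \<le> \<delta> * real j"
      using that \<delta>(1) by simp
    then have near: "norm (v j - of_nat j) \<le> 2 * \<delta> * real j"
      using drift[of j] N(2) norm_triangle_ineq[of "v j - v 0 - of_nat j" "v 0"]
      by (simp add: algebra_simps)
    also have "\<dots> \<le> 1 / 2 * real j"
      using \<delta>(2) j by (intro mult_right_mono) auto
    finally have v_large: "norm (v j) \<ge> real j / 2"
      using norm_triangle_ineq2[of "of_nat j :: complex" "v j"]
      by (simp add: norm_minus_commute)
    \<comment> \<open>This compares \<open>j * z j\<close> with \<open>b\<close> through the two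
      known errors. Together they are at most \<open>\<delta> * j * (1 + 2 * norm b)\<close>; the
      third condition on \<delta> bounds this by \<open>j / 2 * (Re b / 2)\<close>, and
      \<open>norm (v j) \<ge> j / 2\<close> then lets \<open>v j\<close> be cancelled.\<close>
    have "v j * (of_nat j * z j - b) = of_nat j * (z j * v j - b) - b * (v j - of_nat j)"
      by (simp add: algebra_simps)
    then have "norm (v j) * norm (of_nat j * z j - b)
        \<le> norm (of_nat j * (z j * v j - b)) + norm (b * (v j - of_nat j))"
      by (metis norm_mult norm_triangle_ineq4)
    also have "\<dots> \<le> real j * \<delta> + norm b * (2 * \<delta> * real j)"
      unfolding norm_mult using z[of j] near by (intro add_mono mult_mono) auto
    also have "\<dots> = real j * (4 * \<delta> * (1 + 2 * norm b)) / 4"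
      by (simp add: algebra_simps)
    also have "\<dots> \<le> real j / 2 * (Re b / 2)"
      using mult_left_mono[OF \<delta>(3), of "real j"] by linarith
    also have "\<dots> \<le> norm (v j) * (Re b / 2)"
      using v_large b by (intro mult_right_mono) auto
    finally have "norm (of_nat j * z j - b) \<le> Re b / 2"
      using v_large j by (smt (verit) half_gt_zero mult_le_cancel_left_pos)
    then have "\<bar>real j * Re (z j) - Re b\<bar> \<le> Re b / 2"
      using abs_Re_le_cmod[of "of_nat j * z j - b"] by simp
    then have "Re b / 2 \<le> real j * Re (z j)"
      by linarith
    then have "Re b / 2 / real j \<le> Re (z j)"
      using j by (subst pos_divide_le_eq) (simp_all only: mult.commute)
    also have "1 + Re (z j) \<le> norm (1 + z j)"
      using complex_Re_le_cmod[of "1 + z j"] by simp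
    finally show ?thesis
      by (simp add: y(1) norm_mult mult_left_mono)
  qed
  then show ?thesis
    using unbounded_of_harmonic_growth[of "Re b / 2" "\<lambda>j. norm (y j)" N B] b y(2) by simp
qed

section \<open>First-order expansions of products of factors tending to 1\<close>

text \<open>The splitting \<open>F * G - 1 = (F - 1) + F * (G - 1)\<close> shows that first-order
  coefficients relative to \<open>m\<close> add up.\<close>

lemma tendsto_quotient_mult:
  fixes F G m :: "'a \<Rightarrow> complex"
  assumes "(F \<longlongrightarrow> 1) Fl" "((\<lambda>x. (F x - 1) / m x) \<longlongrightarrow> \<alpha>) Fl" "((\<lambda>x. (G x - 1) / m x) \<longlongrightarrow> \<beta>) Fl"
  shows "((\<lambda>x. (F x * G x - 1) / m x) \<longlongrightarrow> \<alpha> + \<beta>) Fl"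
proof -
  have "((\<lambda>x. (F x - 1) / m x + F x * ((G x - 1) / m x)) \<longlongrightarrow> \<alpha> + 1 * \<beta>) Fl"
    by (intro tendsto_intros assms)
  moreover have "(F x - 1) / m x + F x * ((G x - 1) / m x) = (F x * G x - 1) / m x" for x
    by (simp add: algebra_simps flip: add_divide_distrib)
  ultimately show ?thesis by simp
qed

lemma tendsto_quotient_power:
  fixes F m :: "'a \<Rightarrow> complex"
  assumes "(F \<longlongrightarrow> 1) Fl" "((\<lambda>x. (F x - 1) / m x) \<longlongrightarrow> \<alpha>) Fl"
  shows "((\<lambda>x. (F x ^ n - 1) / m x) \<longlongrightarrow> \<alpha> * of_nat n) Fl"
proof (induction n)
  case (Suc n)
  from tendsto_quotient_mult[OF assms Suc] show ?case
    by (simp add: algebra_simps)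
qed simp

lemma tendsto_quotient_prod:
  fixes F :: "'k \<Rightarrow> 'a \<Rightarrow> complex" and m :: "'a \<Rightarrow> complex"
  assumes "finite K" "\<And>k. k \<in> K \<Longrightarrow> (F k \<longlongrightarrow> 1) Fl"
    "\<And>k. k \<in> K \<Longrightarrow> ((\<lambda>x. (F k x - 1) / m x) \<longlongrightarrow> \<alpha> k) Fl"
  shows "((\<lambda>x. ((\<Prod>k\<in>K. F k x) - 1) / m x) \<longlongrightarrow> (\<Sum>k\<in>K. \<alpha> k)) Fl"
  using assms
proof (induction K rule: finite_induct)
  case (insert k K)
  then show ?case
    using tendsto_quotient_mult[of "F k" Fl m "\<alpha> k" "\<lambda>x. \<Prod>k\<in>K. F k x"] by simp
qed simp

section \<open>Exit times and limits at the origin\<close>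

text \<open>The least index outside \<open>U\<close> serves as exit time. Escape can thus be proved
  by refuting an orbit that stays in \<open>U\<close> forever.\<close>

lemma orbit_leavesI:
  assumes "\<not> (\<forall>j. (h ^^ j) p \<in> U)"
  shows "orbit_leaves h U p"
  unfolding orbit_leaves_def using exists_least_iff[of "\<lambda>j. (h ^^ j) p \<notin> U"] assms by auto

lemma holomorphic_germ_tendsto_0:
  assumes "holomorphic_germ h"
  shows "(h \<longlongrightarrow> 0) (at 0)"
proof -
  obtain D where "(h has_derivative D) (at 0)" and "h 0 = 0"
    using assms by (auto simp: holomorphic_germ_def holomorphic_scalar_on_def)
  then show ?thesis
    using has_derivative_continuous[of h D 0 UNIV] continuous_within[of 0 UNIV h] by simp
qed

lemma tendsto_monomial_0:
  fixes M :: "nat ^ 'n"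
  assumes "M \<noteq> 0"
  shows "(monomial M \<longlongrightarrow> 0) (at 0)"
proof -
  obtain k where k: "M $ k \<noteq> 0"
    using assms by (auto simp: vec_eq_iff)
  have "((\<lambda>x :: complex ^ 'n. \<Prod>k\<in>UNIV. (x $ k) ^ (M $ k)) \<longlongrightarrow> (\<Prod>k\<in>UNIV. 0 ^ (M $ k))) (at 0)"
    by (intro tendsto_intros) (auto intro!: tendsto_eq_intros)
  moreover have "(\<Prod>k\<in>UNIV. (0::complex) ^ (M $ k)) = 0"
    using k by (auto intro!: prod_zero)
  ultimately show ?thesis
    by (simp add: monomial_def[abs_def])
qed

section \<open>One step of the map near the origin\<close>

context
  fixes f :: "complex ^ 'n \<Rightarrow> complex ^ 'n" and A :: "'n \<Rightarrow> complex ^ 'n \<Rightarrow> complex"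
    and a :: "complex ^ 'n" and M :: "nat ^ 'n"
begin

definition factor :: "'n \<Rightarrow> complex ^ 'n \<Rightarrow> complex"
  where "factor k x = 1 + monomial M x * (a $ k + A k x)"

text \<open>All estimates on the step from \<open>x\<close> to \<open>f x\<close>, stated with x^M
  \<noteq> 0 in mind. With u = 1 / (<a,M> x^M), the first bound says that u drops by nearly 1. The
  second controls \<open>(factor i x - 1)\<close> times u, for forward orbits; the third controls
  \<open>(1 - 1 / factor i x)\<close> times u, for backward orbits.\<close>

definition good_point :: "'n \<Rightarrow> real \<Rightarrow> complex ^ 'n \<Rightarrow> bool"
  where "good_point i \<delta> x \<longleftrightarrow>
    monomial M (f x) \<noteq> 0 \<and> factor i x \<noteq> 0 \<and> f x $ i = x $ i * factor i x \<and>
    norm (1 / (weight a M * monomial M (f x)) - 1 / (weight a M * monomial M x) + 1) \<le> \<delta> \<and>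
    norm ((a $ i + A i x) / weight a M - a $ i / weight a M) \<le> \<delta> \<and>
    norm ((a $ i + A i x) / weight a M / factor i x - a $ i / weight a M) \<le> \<delta>"

text \<open>Every bound is a limit at the origin. Restricting the filter to x^M \<noteq> 0 permits
  division by x^M.\<close>

lemma eventually_good_point:
  assumes A: "\<And>k. holomorphic_germ (A k)"
    and f: "\<forall>\<^sub>F x in nhds 0. \<forall>k. f x $ k = x $ k * factor k x"
    and w: "weight a M \<noteq> 0" and \<delta>: "\<delta> > 0"
  shows "\<forall>\<^sub>F x in at 0 within {x. monomial M x \<noteq> 0}. good_point i \<delta> x"
proof -
  define Fl where "Fl = at (0 :: complex ^ 'n) within {x. monomial M x \<noteq> 0}"
  define w where "w = weight a M"
  have [simp]: "w \<noteq> 0" using w by (simp add: w_def)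
  have at: "Fl \<le> at 0" by (simp add: Fl_def at_le)
  have m_ne: "\<forall>\<^sub>F x in Fl. monomial M x \<noteq> 0"
    by (simp add: Fl_def eventually_at_filter)
  have "M \<noteq> 0" using w by (auto simp: weight_def)
  then have m: "(monomial M \<longlongrightarrow> 0) Fl"
    using tendsto_monomial_0 tendsto_mono at by blast
  have h: "((\<lambda>x. a $ k + A k x) \<longlongrightarrow> a $ k) Fl" for k
    using tendsto_add[OF tendsto_const tendsto_mono[OF at holomorphic_germ_tendsto_0[OF A]]] by simp
  have fac: "(factor k \<longlongrightarrow> 1) Fl" for k
    using tendsto_add[OF tendsto_const[of 1] tendsto_mult[OF m h[of k]]]
    by (simp add: factor_def[abs_def])
  \<comment> \<open>\<open>P x\<close> is the factor by which \<open>f\<close> multiplies x^M. Its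
    expansion 1 + <a,M> x^M + o(x^M) makes u shift by -1.\<close>
  define P where "P x = (\<Prod>k\<in>UNIV. factor k x ^ (M $ k))" for x
  have "((\<lambda>x. (factor k x - 1) / monomial M x) \<longlongrightarrow> a $ k) Fl" for k
    using h[of k] by (rule Lim_transform_eventually)
      (use m_ne in \<open>auto simp: factor_def elim!: eventually_mono\<close>)
  then have "((\<lambda>x. (factor k x ^ (M $ k) - 1) / monomial M x) \<longlongrightarrow> a $ k * of_nat (M $ k)) Fl" for k
    using tendsto_quotient_power[OF fac] by blast
  moreover have "((\<lambda>x. factor k x ^ (M $ k)) \<longlongrightarrow> 1) Fl" for k
    using tendsto_power[OF fac[of k], of "M $ k"] by simp
  ultimately have Pq: "((\<lambda>x. (P x - 1) / monomial M x) \<longlongrightarrow> w) Fl"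
    unfolding P_def w_def weight_def by (intro tendsto_quotient_prod) auto
  have P: "(P \<longlongrightarrow> 1) Fl"
    unfolding P_def[abs_def] using tendsto_prod[of UNIV "\<lambda>k x. factor k x ^ (M $ k)" "\<lambda>_. 1" Fl]
      tendsto_power[OF fac] by fastforce
  \<comment> \<open>This is u(f x) - u(x) + 1 written through \<open>P\<close>; the limit is - w / w
    + 1.\<close>
  have step: "((\<lambda>x. - ((P x - 1) / monomial M x / (w * P x)) + 1) \<longlongrightarrow> 0) Fl"
    by (rule tendsto_eq_intros Pq P | simp)+
  have small: "\<forall>\<^sub>F x in Fl. norm (t x - l) \<le> \<delta>" if "(t \<longlongrightarrow> l) Fl" for t :: "_ \<Rightarrow> complex" and l
    using tendstoD[OF that \<delta>] by (auto simp: dist_norm elim!: eventually_mono)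
  have "\<forall>\<^sub>F x in Fl. \<forall>k. f x $ k = x $ k * factor k x"
    using f by (auto simp: Fl_def eventually_at_filter elim: eventually_mono)
  moreover have "\<forall>\<^sub>F x in Fl. P x \<noteq> 0" "\<forall>\<^sub>F x in Fl. factor i x \<noteq> 0"
    using tendsto_imp_eventually_ne[OF P] tendsto_imp_eventually_ne[OF fac] by auto
  moreover have "\<forall>\<^sub>F x in Fl. norm (- ((P x - 1) / monomial M x / (w * P x)) + 1) \<le> \<delta>"
    using small[OF step] by simp
  moreover have "\<forall>\<^sub>F x in Fl. norm ((a $ i + A i x) / w - a $ i / w) \<le> \<delta>"
    by (intro small tendsto_intros h) simp
  moreover have "\<forall>\<^sub>F x in Fl. norm ((a $ i + A i x) / w / factor i x - a $ i / w) \<le> \<delta>"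
    by (intro small) (rule tendsto_eq_intros h fac | simp)+
  ultimately have "\<forall>\<^sub>F x in Fl. good_point i \<delta> x"
    using m_ne
  proof eventually_elim
    case (elim x)
    have mf: "monomial M (f x) = monomial M x * P x"
      using elim(1) by (simp add: monomial_def P_def power_mult_distrib prod.distrib)
    have "1 / (w * monomial M (f x)) - 1 / (w * monomial M x)
        = - ((P x - 1) / monomial M x / (w * P x))"
      using elim by (simp add: mf field_simps)
    with elim show ?case
      by (simp add: good_point_def mf flip: w_def)
  qed
  then show ?thesis by (simp add: Fl_def)
qed

section \<open>Orbits trapped in a neighbourhood\<close>

context
  fixes U :: "(complex ^ 'n) set" and i :: 'n and \<delta> :: real
  assumes U: "\<And>x. x \<in> U \<Longrightarrow> monomial M x \<noteq> 0 \<Longrightarrow> good_point i \<delta> x"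
    and U_bounded: "\<And>x. x \<in> U \<Longrightarrow> norm x \<le> 1"
    and a: "Re (a $ i / weight a M) < 0" and w: "weight a M \<noteq> 0"
    and \<delta>: "\<delta> > 0" "4 * \<delta> \<le> 1"
      "4 * \<delta> * (1 + 2 * norm (a $ i / weight a M)) \<le> - Re (a $ i / weight a M)"
begin

text \<open>Common end of both directions: with b = -a_i/<a,M>, of positive real part, the
  \<open>i\<close>-th coordinate must exceed 1 in modulus, while \<open>U\<close> lies in the closed
  unit ball.\<close>

lemma no_escape_contradiction:
  assumes v: "\<And>j. norm (v (Suc j) - v j - 1) \<le> \<delta>"
    and z: "\<And>j. norm (z j * v j + a $ i / weight a M) \<le> \<delta>"
    and y: "\<And>j. x (Suc j) $ i = x j $ i * (1 + z j)" "\<And>j. x j $ i \<noteq> 0"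
    and x: "\<And>j. x j \<in> U"
  shows False
proof -
  obtain j where "norm (x j $ i) > 1"
    using unbounded_of_near_translation[of "- (a $ i / weight a M)" \<delta> v z "\<lambda>j. x j $ i" 1]
      assms a \<delta> by auto
  then show False
    using U_bounded[OF x[of j]] Finite_Cartesian_Product.norm_nth_le[of "x j" i]
    by (meson not_less order_trans)
qed

lemma forward_orbit_leaves:
  assumes p: "monomial M p \<noteq> 0" "p $ i \<noteq> 0"
  shows "orbit_leaves f U p"
proof (rule orbit_leavesI, rule notI)
  assume "\<forall>j. (f ^^ j) p \<in> U"
  define x where "x j = (f ^^ j) p" for j
  have x: "x j \<in> U" for j
    using \<open>\<forall>j. (f ^^ j) p \<in> U\<close> by (simp add: x_def)
  have fx: "f (x j) = x (Suc j)" for j by (simp add: x_def)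
  have m: "monomial M (x j) \<noteq> 0" for j
  proof (induction j)
    case (Suc j)
    then show ?case using U[OF x] by (simp add: good_point_def flip: fx)
  qed (use p in \<open>simp add: x_def\<close>)
  note good = U[OF x m, unfolded good_point_def fx]
  have ne: "x j $ i \<noteq> 0" for j
  proof (induction j)
    case (Suc j)
    then show ?case using good[of j] by simp
  qed (use p in \<open>simp add: x_def\<close>)
  \<comment> \<open>The sign turns the forward shift of u by -1 into the required +1. In
    \<open>?z j * ?v j\<close> the monomial cancels.\<close>
  let ?v = "\<lambda>j. - (1 / (weight a M * monomial M (x j)))"
  let ?z = "\<lambda>j. factor i (x j) - 1"
  show False
  proof (rule no_escape_contradiction[of ?v ?z x])
    show "norm (?v (Suc j) - ?v j - 1) \<le> \<delta>" for j
    proof -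
      have "?v (Suc j) - ?v j - 1 = - (1 / (weight a M * monomial M (x (Suc j)))
          - 1 / (weight a M * monomial M (x j)) + 1)" by simp
      then show ?thesis using good[of j] by (metis norm_minus_cancel)
    qed
    show "norm (?z j * ?v j + a $ i / weight a M) \<le> \<delta>" for j
    proof -
      have "?z j * ?v j = - ((a $ i + A i (x j)) / weight a M)"
        using m[of j] w by (simp add: factor_def)
      then have "?z j * ?v j + a $ i / weight a M
          = - ((a $ i + A i (x j)) / weight a M - a $ i / weight a M)" by simp
      then show ?thesis using good[of j] by (metis norm_minus_cancel)
    qed
  qed (use good ne x in auto)
qed

lemma backward_orbit_leaves:
  assumes p: "monomial M p \<noteq> 0" "p $ i \<noteq> 0"
    and g: "\<And>x. x \<in> U \<Longrightarrow> f (g x) = x"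
    and formula: "\<And>x k. x \<in> U \<Longrightarrow> f x $ k = x $ k * factor k x"
  shows "orbit_leaves g U p"
proof (rule orbit_leavesI, rule notI)
  assume "\<forall>j. (g ^^ j) p \<in> U"
  define x where "x j = (g ^^ j) p" for j
  have x: "x j \<in> U" for j
    using \<open>\<forall>j. (g ^^ j) p \<in> U\<close> by (simp add: x_def)
  have fx: "f (x (Suc j)) = x j" for j using g[OF x[of j]] by (simp add: x_def)
  \<comment> \<open>Divisibility carries nonvanishing of x^M from a point to its preimage. It comes
    from the product formula, since \<open>good_point\<close> is available only once x^M \<noteq> 0
    is known at the preimage.\<close>
  have dvd: "monomial M y dvd monomial M (f y)" if "y \<in> U" for y
    using formula[OF that] by (simp add: monomial_def power_mult_distrib prod.distrib)
  have m: "monomial M (x j) \<noteq> 0" for j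
  proof (induction j)
    case (Suc j)
    then show ?case using dvd[OF x[of "Suc j"]] by (auto simp: fx)
  qed (use p in \<open>simp add: x_def\<close>)
  have good: "good_point i \<delta> (x (Suc j))" for j by (rule U[OF x m])
  note good = good[unfolded good_point_def fx]
  have ne: "x j $ i \<noteq> 0" for j
  proof (induction j)
    case (Suc j)
    then show ?case using good[of j] by auto
  qed (use p in \<open>simp add: x_def\<close>)
  let ?v = "\<lambda>j. 1 / (weight a M * monomial M (x (Suc j)))"
  let ?z = "\<lambda>j. 1 / factor i (x (Suc j)) - 1"
  show False
  proof (rule no_escape_contradiction[of ?v ?z x])
    show "norm (?v (Suc j) - ?v j - 1) \<le> \<delta>" for j
    proof -
      have "?v (Suc j) - ?v j - 1 = - (?v j - ?v (Suc j) + 1)" by simp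
      then show ?thesis using good[of "Suc j"] by (metis norm_minus_cancel)
    qed
    show "norm (?z j * ?v j + a $ i / weight a M) \<le> \<delta>" for j
    proof -
      have "?z j = - (monomial M (x (Suc j)) * (a $ i + A i (x (Suc j)))) / factor i (x (Suc j))"
        using good[of j] by (simp add: factor_def field_simps)
      then have "?z j * ?v j = - ((a $ i + A i (x (Suc j))) / weight a M / factor i (x (Suc j)))"
        using m[of "Suc j"] w by simp
      then have "?z j * ?v j + a $ i / weight a M
          = - ((a $ i + A i (x (Suc j))) / weight a M / factor i (x (Suc j)) - a $ i / weight a M)"
        by simp
      then show ?thesis using good[of j] by (metis norm_minus_cancel)
    qed
    show "x (Suc j) $ i = x j $ i * (1 + ?z j)" for j
      using good[of j] by simp
  qed (use ne x in auto)
qed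

end

end

section \<open>Choice of the neighbourhood\<close>

theorem theorem2:
  fixes f g :: "complex ^ 'n \<Rightarrow> complex ^ 'n"
    and W V :: "(complex ^ 'n) set"
    and A :: "'n \<Rightarrow> complex ^ 'n \<Rightarrow> complex"
    and a :: "complex ^ 'n"
    and M :: "nat ^ 'n"
    and i :: 'n
  assumes "biholomorphic_germ f W g V"
    and "\<And>k. holomorphic_germ (A k)"
    and "\<And>k. a $ k \<noteq> 0"
    and "\<forall>\<^sub>F x in nhds 0. \<forall>k. f x $ k = x $ k * (1 + monomial M x * (a $ k + A k x))"
    and "weight a M \<noteq> 0"
    and "Re (a $ i / weight a M) < 0"
  shows "\<exists>U. open U \<and> 0 \<in> U \<and> U \<subseteq> W \<inter> V \<and>
    (\<forall>p\<in>U. monomial M p \<noteq> 0 \<and> (M $ i = 0 \<longrightarrow> p $ i \<noteq> 0) \<longrightarrow>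
       orbit_leaves f U p \<and> orbit_leaves g U p)"
proof -
  define c where "c = - Re (a $ i / weight a M)"
  define C where "C = 1 + 2 * norm (a $ i / weight a M)"
  \<comment> \<open>With b = -a_i/<a,M>, \<open>c\<close> is Re b and \<open>C\<close> is 1 + 2 |b|;
    the two entries of the minimum give the two smallness conditions of the growth argument.\<close>
  define \<delta> where "\<delta> = min (1 / 4) (c / (4 * C))"
  have "c > 0" "C > 0" using assms(6) by (auto simp: c_def C_def add_pos_nonneg)
  then have \<delta>: "\<delta> > 0" "4 * \<delta> \<le> 1" "4 * \<delta> * C \<le> c"
    by (auto simp: \<delta>_def min_def field_simps)
  have WV: "open W" "0 \<in> W" "open V" "0 \<in> V" and fg: "\<And>y. y \<in> V \<Longrightarrow> f (g y) = y"
    using assms(1) by (auto simp: biholomorphic_germ_def)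
  have formula: "\<forall>\<^sub>F x in nhds 0. \<forall>k. f x $ k = x $ k * factor A a M k x"
    using assms(4) by (simp add: factor_def)
  have "M \<noteq> 0" using assms(5) by (auto simp: weight_def)
  \<comment> \<open>The punctured filter says nothing at 0 itself; as x^M vanishes there, the
    estimates hold wherever x^M \<noteq> 0 in a full neighbourhood.\<close>
  then have m0: "monomial M 0 = 0" by (auto simp: monomial_def vec_eq_iff)
  from eventually_good_point[OF assms(2) formula assms(5) \<delta>(1)]
  obtain S where S: "open S" "0 \<in> S"
    "\<And>x. x \<in> S \<Longrightarrow> monomial M x \<noteq> 0 \<Longrightarrow> good_point f A a M i \<delta> x"
    using m0 unfolding eventually_at_topological mem_Collect_eq by metis
  obtain T where T: "open T" "0 \<in> T" "\<And>x k. x \<in> T \<Longrightarrow> f x $ k = x $ k * factor A a M k x"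
    using formula by (auto simp: eventually_nhds)
  define U where "U = S \<inter> T \<inter> W \<inter> V \<inter> ball 0 1"
  have "orbit_leaves f U p \<and> orbit_leaves g U p"
    if "p \<in> U" and p: "monomial M p \<noteq> 0" "M $ i = 0 \<longrightarrow> p $ i \<noteq> 0" for p
  proof -
    \<comment> \<open>If \<open>M $ i\<close> is positive, x_i divides x^M; otherwise the extra
      condition on \<open>p\<close> applies.\<close>
    have pi: "p $ i \<noteq> 0"
      using p by (cases "M $ i = 0") (auto simp: monomial_def)
    have U: "good_point f A a M i \<delta> x" if "x \<in> U" "monomial M x \<noteq> 0" for x
      using S(3) that by (auto simp: U_def)
    have U_bounded: "norm x \<le> 1" if "x \<in> U" for x
      using that by (simp add: U_def)
    note ctx = U U_bounded assms(6,5) \<delta>[unfolded C_def c_def]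
    show ?thesis
    proof
      show "orbit_leaves f U p"
        using ctx p(1) pi by (rule forward_orbit_leaves)
      show "orbit_leaves g U p"
        using ctx p(1) pi by (rule backward_orbit_leaves) (auto simp: U_def fg T(3))
    qed
  qed
  moreover have "open U" "0 \<in> U" "U \<subseteq> W \<inter> V"
    using S T WV by (auto simp: U_def)
  ultimately show ?thesis by blast
qed

end
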